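(* Let $T$ be a set of cardinality greater than $\aleph_0$, let $\mathcal{A}$ be a $\sigma$-algebra of subsets of $T$, let $\mu:\mathcal{A}\to[0,\infty)$ be a countably additive measure with $\mu(T)>0$, let $X$ be a Banach space and let $F:T\to b(X)$ be a bounded multifunction. Then $F$ is Birkhoff simple integrable on $T$ with respect to $\mu$ if and only if $F$ is Gould integrable on $T$ with respect to $\mu$, and in this case $$(B_s)\int_T F\,d\mu=(G)\int_T F\,d\mu .$$
   Context: $(X,\|\cdot\|)$ is a Banach space; $b(X)$ is the family of nonempty bounded subsets of $X$ and $bf(X)$ the family of nonempty closed bounded subsets of $X$. For nonempty $A,B\subset X$ put $e(A,B)=\sup_{x\in A}\inf_{y\in B}\|x-y\|$, $h(A,B)=\max\{e(A,B),e(B,A)\}$, and $|A|=h(A,\{0\})=\sup_{x\in A}\|x\|$. Finite sums $\sum$ of subsets of $X$ denote the norm closure of the Minkowski sum. $F:T\to b(X)$ is bounded if there is $M\ge 0$ with $|F(t)|\le M$ for all $t\in T$. Partitions: a finite (countable) partition of $T$ is a finite (countable) family of nonempty pairwise disjoint members of $\mathcal{A}$ with union $T$. A countable partition may be finite; if it has $N$ members, sums $\sum_{i=1}^n$ over it with $n\ge N$ mean the sum over all $N$ members. $P'\ge P$ ($P'$ is finer than $P$) means that every set of $P'$ is included in some set of $P$. Gould integrability: $F$ is Gould integrable on $T$ with respect to $\mu$ if there is $I\in bf(X)$ such that for every $\varepsilon>0$ there is a finite partition $P_\varepsilon$ of $T$ (into sets of finite measure) such that for every finite partition $P=\{A_i\}_{i=1}^n$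 of $T$ with $P\ge P_\varepsilon$ and all $t_i\in A_i$, $h(\sum_{i=1}^nF(t_i)\mu(A_i),I)<\varepsilon$. Then $I=(G)\int_TF\,d\mu$. Birkhoff simple integrability: $F$ is Birkhoff simple integrable on $T$ with respect to $\mu$ if there is a closed set $I\in b(X)$ such that for every $\varepsilon>0$ there is a countable partition $P_\varepsilon$ of $T$ such that for every countable partition $P=\{A_n\}_{n\in\mathbb{N}}$ of $T$ with $P\ge P_\varepsilon$ (in any enumeration) and all $t_n\in A_n$, $\limsup_n h(\sum_{i=1}^nF(t_i)\mu(A_i),I)\le\varepsilon$. Then $I=(B_s)\int_TF\,d\mu$. *)

theory Defs
  imports "HOL-Analysis.Analysis"
begin

section \<open>Excess, Hausdorff distance, sums of sets\<close>

text \<open>Extended-real valued, so that the formulas are right for arbitrary nonempty sets,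
  bounded or not.\<close>

definition excess :: "'x::real_normed_vector set \<Rightarrow> 'x set \<Rightarrow> ereal" where
  "excess A B = (SUP x\<in>A. INF y\<in>B. ereal (norm (x - y)))"

definition hausd :: "'x::real_normed_vector set \<Rightarrow> 'x set \<Rightarrow> ereal" where
  "hausd A B = max (excess A B) (excess B A)"

text \<open>The sum under the closure is the Minkowski sum from \<^theory>\<open>HOL-Library.Set_Algebras\<close>.\<close>

definition closed_sum :: "('i \<Rightarrow> 'x::real_normed_vector set) \<Rightarrow> 'i set \<Rightarrow> 'x set" where
  "closed_sum S I = closure (\<Sum>i\<in>I. S i)"

definition weighted :: "'a measure \<Rightarrow> ('a \<Rightarrow> 'x::real_normed_vector set) \<Rightarrow> 'a \<Rightarrow> 'a set \<Rightarrow> 'x set" where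
  "weighted M F t A = (\<lambda>x. measure M A *\<^sub>R x) ` F t"

definition bounded_multifunction :: "'a set \<Rightarrow> ('a \<Rightarrow> 'x::real_normed_vector set) \<Rightarrow> bool" where
  "bounded_multifunction T F \<longleftrightarrow> (\<exists>C\<ge>0. \<forall>t\<in>T. hausd (F t) {0} \<le> ereal C)"

section \<open>Partitions\<close>

text \<open>The members of a partition are nonempty and pairwise disjoint, so a partition can be
  given as a set of sets; the order of its members is fixed by a separate enumeration.\<close>

definition finite_partition :: "'a measure \<Rightarrow> 'a set set \<Rightarrow> bool" where
  "finite_partition M P \<longleftrightarrow> partition_on (space M) P \<and> P \<subseteq> sets M \<and> finite P"

definition countable_partition :: "'a measure \<Rightarrow> 'a set set \<Rightarrow> bool" where
  "countable_partition M P \<longleftrightarrow> partition_on (space M) P \<and> P \<subseteq> sets M \<and> countable P"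

text \<open>A finite family with \<open>N\<close> members is enumerated by \<open>0, \<dots>, N - 1\<close>, an infinite one by
  all natural numbers.\<close>

definition index_set :: "'a set set \<Rightarrow> nat set" where
  "index_set P = (if finite P then {..<card P} else UNIV)"

definition enumeration :: "(nat \<Rightarrow> 'a set) \<Rightarrow> 'a set set \<Rightarrow> bool" where
  "enumeration A P \<longleftrightarrow> bij_betw A (index_set P) P"

section \<open>Gould integral\<close>

definition has_gould_integral ::
  "'a measure \<Rightarrow> ('a \<Rightarrow> 'x::real_normed_vector set) \<Rightarrow> 'x set \<Rightarrow> bool" where
  "has_gould_integral M F I \<longleftrightarrow>
     I \<noteq> {} \<and> closed I \<and> bounded I \<and>
     (\<forall>\<epsilon>::real. \<epsilon> > 0 \<longrightarrow>
       (\<exists>P\<^sub>\<epsilon>. finite_partition M P\<^sub>\<epsilon> \<and> (\<forall>B\<in>P\<^sub>\<epsilon>. emeasure M B < \<infinity>) \<and>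
         (\<forall>P t. finite_partition M P \<and> refines (space M) P P\<^sub>\<epsilon> \<and> (\<forall>A\<in>P. t A \<in> A) \<longrightarrow>
           hausd (closed_sum (\<lambda>A. weighted M F (t A) A) P) I < ereal \<epsilon>)))"

definition gould_integrable :: "'a measure \<Rightarrow> ('a \<Rightarrow> 'x::real_normed_vector set) \<Rightarrow> bool" where
  "gould_integrable M F \<longleftrightarrow> (\<exists>I. has_gould_integral M F I)"

definition gould_integral :: "'a measure \<Rightarrow> ('a \<Rightarrow> 'x::real_normed_vector set) \<Rightarrow> 'x set" where
  "gould_integral M F = (THE I. has_gould_integral M F I)"

section \<open>Birkhoff simple integral\<close>

text \<open>Intersecting with \<^const>\<open>index_set\<close> makes the partial sums over a finite partition
  constant once all its members are included.\<close>

definition has_birkhoff_simple_integral ::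
  "'a measure \<Rightarrow> ('a \<Rightarrow> 'x::real_normed_vector set) \<Rightarrow> 'x set \<Rightarrow> bool" where
  "has_birkhoff_simple_integral M F I \<longleftrightarrow>
     I \<noteq> {} \<and> closed I \<and> bounded I \<and>
     (\<forall>\<epsilon>::real. \<epsilon> > 0 \<longrightarrow>
       (\<exists>P\<^sub>\<epsilon>. countable_partition M P\<^sub>\<epsilon> \<and>
         (\<forall>P A t. countable_partition M P \<and> refines (space M) P P\<^sub>\<epsilon> \<and> enumeration A P \<and>
             (\<forall>i\<in>index_set P. t i \<in> A i) \<longrightarrow>
           limsup (\<lambda>n. hausd (closed_sum (\<lambda>i. weighted M F (t i) (A i)) ({..<n} \<inter> index_set P)) I)
             \<le> ereal \<epsilon>)))"

definition birkhoff_simple_integrable ::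
  "'a measure \<Rightarrow> ('a \<Rightarrow> 'x::real_normed_vector set) \<Rightarrow> bool" where
  "birkhoff_simple_integrable M F \<longleftrightarrow> (\<exists>I. has_birkhoff_simple_integral M F I)"

definition birkhoff_simple_integral ::
  "'a measure \<Rightarrow> ('a \<Rightarrow> 'x::real_normed_vector set) \<Rightarrow> 'x set" where
  "birkhoff_simple_integral M F = (THE I. has_birkhoff_simple_integral M F I)"

section \<open>Uniqueness of the integrals\<close>

lemma hausd_commute: "hausd A B = hausd B A"
  by (simp add: hausd_def max.commute)

lemma excess_lessD:
  assumes "excess A B < ereal r" "x \<in> A"
  obtains y where "y \<in> B" "norm (x - y) < r"
proof -
  have "(INF y\<in>B. ereal (norm (x - y))) < ereal r"
    using assms unfolding excess_def by (meson SUP_upper le_less_trans)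
  then show ?thesis using that by (auto simp: INF_less_iff)
qed

lemma subset_of_hausd_close:
  assumes close: "\<And>\<epsilon>::real. \<epsilon> > 0 \<Longrightarrow> \<exists>S. hausd S I < ereal \<epsilon> \<and> hausd S J < ereal \<epsilon>"
    and "closed J"
  shows "I \<subseteq> J"
proof
  fix x assume x: "x \<in> I"
  have "x \<in> closure J"
    unfolding closure_approachable
  proof (intro allI impI)
    fix e :: real assume "0 < e"
    then obtain S where S: "hausd S I < ereal (e/2)" "hausd S J < ereal (e/2)"
      using close[of "e/2"] by auto
    then have "excess I S < ereal (e/2)" "excess S J < ereal (e/2)"
      by (auto simp: hausd_def)
    then obtain y z where "y \<in> S" "norm (x - y) < e/2" "z \<in> J" "norm (y - z) < e/2"
      using x by (metis excess_lessD)
    then have "dist z x < e"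
      using norm_triangle_lt[of "x - y" "y - z" e] by (simp add: dist_norm norm_minus_commute)
    with \<open>z \<in> J\<close> show "\<exists>y\<in>J. dist y x < e" by blast
  qed
  with \<open>closed J\<close> show "x \<in> J" by simp
qed

lemma countable_partition_common_refinement:
  assumes "countable_partition M P" "countable_partition M Q"
  obtains R where "countable_partition M R" "refines (space M) R P" "refines (space M) R Q"
    "finite P \<Longrightarrow> finite Q \<Longrightarrow> finite R"
proof
  let ?R = "(\<lambda>(A, B). A \<inter> B) ` (P \<times> Q) - {{}}"
  have P: "partition_on (space M) P" and Q: "partition_on (space M) Q"
    using assms by (auto simp: countable_partition_def)
  have part: "partition_on (space M) ?R"
  proof (rule partition_onI)
    show "\<Union> ?R = space M"
    proof
      show "space M \<subseteq> \<Union> ?R"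
      proof
        fix x assume "x \<in> space M"
        then obtain A B where "A \<in> P" "B \<in> Q" "x \<in> A \<inter> B"
          using partition_onD1[OF P] partition_onD1[OF Q] by blast
        then have "A \<inter> B \<in> ?R" by auto
        then show "x \<in> \<Union> ?R" using \<open>x \<in> A \<inter> B\<close> by (rule UnionI)
      qed
    qed (use partition_onD1[OF P] in auto)
    fix C D assume "C \<in> ?R" "D \<in> ?R" "C \<noteq> D"
    then obtain A B A' B' where *: "A \<in> P" "B \<in> Q" "C = A \<inter> B" "A' \<in> P" "B' \<in> Q"
        "D = A' \<inter> B'" "A \<noteq> A' \<or> B \<noteq> B'"
      by auto
    then have "A \<inter> A' = {} \<or> B \<inter> B' = {}"
      using disjointD[OF partition_onD2[OF P]] disjointD[OF partition_onD2[OF Q]] by metis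
    then show "disjnt C D" using * by (auto simp: disjnt_def)
  qed auto
  show "refines (space M) ?R P" "refines (space M) ?R Q"
    using part P Q by (auto simp: refines_def)
  show "countable_partition M ?R"
    using part assms by (auto simp: countable_partition_def)
  show "finite P \<Longrightarrow> finite Q \<Longrightarrow> finite ?R" by auto
qed

lemma finite_partition_iff: "finite_partition M P \<longleftrightarrow> countable_partition M P \<and> finite P"
  by (auto simp: finite_partition_def countable_partition_def countable_finite)

lemma has_gould_integral_unique:
  assumes I: "has_gould_integral M F I" and J: "has_gould_integral M F J"
  shows "I = J"
proof -
  have close: "\<exists>S. hausd S I < ereal e \<and> hausd S J < ereal e" if "e > 0" for e :: real
  proof -
    let ?ok = "\<lambda>I P. finite_partition M P \<and> (\<forall>R t. finite_partition M R \<and> refines (space M) R P \<and>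
      (\<forall>A\<in>R. t A \<in> A) \<longrightarrow> hausd (closed_sum (\<lambda>A. weighted M F (t A) A) R) I < ereal e)"
    have "\<exists>P. ?ok I P" "\<exists>Q. ?ok J Q"
      using I J \<open>e > 0\<close> unfolding has_gould_integral_def by blast+
    then obtain P Q where P: "?ok I P" and Q: "?ok J Q" by blast
    obtain R where R: "finite_partition M R" "refines (space M) R P" "refines (space M) R Q"
      using countable_partition_common_refinement[of M P Q] P Q
      unfolding finite_partition_iff by metis
    have t: "\<forall>A\<in>R. (SOME x. x \<in> A) \<in> A"
      using R(1) by (metis finite_partition_def partition_onD3 some_in_eq)
    let ?S = "closed_sum (\<lambda>A. weighted M F (SOME x. x \<in> A) A) R"
    have "hausd ?S I < ereal e"
      using P R t by (elim conjE allE[of _ R] allE[of _ "\<lambda>A. SOME x. x \<in> A"]) simp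
    moreover have "hausd ?S J < ereal e"
      using Q R t by (elim conjE allE[of _ R] allE[of _ "\<lambda>A. SOME x. x \<in> A"]) simp
    ultimately show ?thesis by blast
  qed
  have "closed I" "closed J" using I J by (auto simp: has_gould_integral_def)
  then show ?thesis
    using subset_of_hausd_close[of I J] subset_of_hausd_close[of J I] close
    by (metis subset_antisym)
qed

lemma has_birkhoff_simple_integral_unique:
  assumes I: "has_birkhoff_simple_integral M F I" and J: "has_birkhoff_simple_integral M F J"
  shows "I = J"
proof -
  let ?s = "\<lambda>P A t n. closed_sum (\<lambda>i. weighted M F (t i) (A i)) ({..<n} \<inter> index_set P)"
  have close: "\<exists>S. hausd S I < ereal e \<and> hausd S J < ereal e" if "e > 0" for e :: real
  proof -
    from that have "e/2 > 0" by simp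
    let ?ok = "\<lambda>I P. countable_partition M P \<and> (\<forall>R A t. countable_partition M R \<and>
      refines (space M) R P \<and> enumeration A R \<and> (\<forall>i\<in>index_set R. t i \<in> A i) \<longrightarrow>
      limsup (\<lambda>n. hausd (?s R A t n) I) \<le> ereal (e/2))"
    have ex: "\<exists>P. ?ok K P" if "has_birkhoff_simple_integral M F K" for K
      using that \<open>e/2 > 0\<close> unfolding has_birkhoff_simple_integral_def
      by (elim conjE allE[of _ "e/2"]) simp
    obtain P where P: "?ok I P" using ex[OF I] by (rule exE)
    obtain Q where Q: "?ok J Q" using ex[OF J] by (rule exE)
    have PQ: "countable_partition M P" "countable_partition M Q" using P Q by simp_all
    obtain R where R: "countable_partition M R" "refines (space M) R P" "refines (space M) R Q"
      using countable_partition_common_refinement[OF PQ] by metis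
    have "countable R" using R(1) by (simp add: countable_partition_def)
    have "\<exists>A. bij_betw A (index_set R) R"
    proof (cases "finite R")
      case True
      then show ?thesis
        using ex_bij_betw_nat_finite[of R] by (simp add: index_set_def atLeast0LessThan)
    next
      case False
      then show ?thesis
        using bij_betw_from_nat_into[OF \<open>countable R\<close>] by (auto simp: index_set_def)
    qed
    then obtain A where A: "enumeration A R" by (auto simp: enumeration_def)
    have t: "\<forall>i\<in>index_set R. (SOME x. x \<in> A i) \<in> A i"
      using R(1) A unfolding countable_partition_def enumeration_def
      by (metis bij_betwE partition_onD3 some_in_eq)
    let ?t = "\<lambda>i. SOME x. x \<in> A i"
    have "limsup (\<lambda>n. hausd (?s R A ?t n) I) \<le> ereal (e/2)"
      using P R t A by (elim conjE allE[of _ R] allE[of _ A] allE[of _ ?t]) simp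
    moreover have "limsup (\<lambda>n. hausd (?s R A ?t n) J) \<le> ereal (e/2)"
      using Q R t A by (elim conjE allE[of _ R] allE[of _ A] allE[of _ ?t]) simp
    moreover have "ereal (e/2) < ereal e" using \<open>e > 0\<close> by simp
    ultimately have "limsup (\<lambda>n. hausd (?s R A ?t n) I) < ereal e"
      "limsup (\<lambda>n. hausd (?s R A ?t n) J) < ereal e"
      by (meson le_less_trans)+
    then have "eventually (\<lambda>n. hausd (?s R A ?t n) I < ereal e \<and> hausd (?s R A ?t n) J < ereal e) sequentially"
      by (intro eventually_conj Limsup_lessD)
    then show ?thesis by (auto dest: eventually_happens)
  qed
  have "closed I" "closed J" using I J by (auto simp: has_birkhoff_simple_integral_def)
  then show ?thesis
    using subset_of_hausd_close[of I J] subset_of_hausd_close[of J I] close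
    by (metis subset_antisym)
qed

end

theory Submission
  imports Defs
begin

text \<open>
  A set \<open>I\<close> is the Birkhoff simple integral exactly if it is the Gould integral. The bridge is
  that a sum over a partition changes by at most \<open>C \<mu>(V)\<close>, where \<open>C\<close> bounds \<open>F\<close>, when its
  members inside \<open>V\<close> are dropped or replaced; and since \<open>\<mu>\<close> is finite and countably additive,
  the tails \<open>V\<close> of a countable partition have arbitrarily small measure. To pass from Gould to
  Birkhoff, the tail of a countable partition is cut only along the finite partition
  \<open>P\<^sub>\<epsilon>\<close>; conversely, the tail of the countable partition \<open>P\<^sub>\<epsilon>\<close> is merged into one set, and
  for a finer finite partition the part inside that set is again cut along \<open>P\<^sub>\<epsilon>\<close>.
\<close>

section \<open>Estimates for the excess and the Hausdorff distance\<close>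

text \<open>The infimum over \<open>B\<close> need not be attained, hence the slack
  \<open>e\<close>. In this form a bound on the excess is proved by matching points one by one,
  without extended reals.\<close>

lemma excess_le_iff:
  "excess A B \<le> ereal r \<longleftrightarrow> (\<forall>x\<in>A. \<forall>e>0. \<exists>y\<in>B. norm (x - y) < r + e)"
proof -
  have "(INF y\<in>B. ereal (norm (x - y))) \<le> ereal r \<longleftrightarrow> (\<forall>e>0. \<exists>y\<in>B. norm (x - y) < r + e)" for x
  proof
    assume le: "(INF y\<in>B. ereal (norm (x - y))) \<le> ereal r"
    show "\<forall>e>0. \<exists>y\<in>B. norm (x - y) < r + e"
    proof (intro allI impI)
      fix e :: real assume "e > 0"
      then have "ereal r < ereal (r + e)" by simp
      then show "\<exists>y\<in>B. norm (x - y) < r + e"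
        using le unfolding INF_le_iff by (metis less_ereal.simps(1))
    qed
  next
    assume *: "\<forall>e>0. \<exists>y\<in>B. norm (x - y) < r + e"
    show "(INF y\<in>B. ereal (norm (x - y))) \<le> ereal r"
    proof (rule ereal_le_epsilon2)
      fix e :: real assume "0 < e"
      with * obtain y where "y \<in> B" "norm (x - y) < r + e" by blast
      then show "(INF y\<in>B. ereal (norm (x - y))) \<le> ereal r + ereal e"
        by (intro INF_lower2[of y]) auto
    qed
  qed
  then show ?thesis by (simp add: excess_def SUP_le_iff)
qed

lemma hausd_le_iff: "hausd A B \<le> c \<longleftrightarrow> excess A B \<le> c \<and> excess B A \<le> c"
  by (simp add: hausd_def)

lemma excess_triangle_le:
  assumes "excess A B \<le> ereal r" "excess B C \<le> ereal s"
  shows "excess A C \<le> ereal (r + s)"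
  unfolding excess_le_iff
proof (intro ballI allI impI)
  fix x e assume "x \<in> A" and "(0::real) < e"
  then have "e/2 > 0" by simp
  then obtain y where y: "y \<in> B" "norm (x - y) < r + e/2"
    using assms(1) \<open>x \<in> A\<close> unfolding excess_le_iff by blast
  then obtain z where z: "z \<in> C" "norm (y - z) < s + e/2"
    using assms(2) \<open>e/2 > 0\<close> unfolding excess_le_iff by blast
  have "norm (x - z) \<le> norm (x - y) + norm (y - z)"
    by (metis norm_triangle_ineq diff_add_cancel add_diff_eq)
  with y z have "norm (x - z) < r + s + e" by simp
  with z show "\<exists>y\<in>C. norm (x - y) < r + s + e" by blast
qed

lemma hausd_triangle_le:
  assumes "hausd A B \<le> ereal r" "hausd B C \<le> ereal s"
  shows "hausd A C \<le> ereal (r + s)"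
  using assms excess_triangle_le[of A B r C s] excess_triangle_le[of C B s A r]
  by (auto simp: hausd_le_iff add.commute)

text \<open>The excess of \<open>closure A\<close> over \<open>A\<close> and of \<open>B\<close>
  over \<open>closure B\<close> is zero, so two uses of the triangle inequality carry the bound
  over.\<close>

lemma excess_closure_le:
  assumes "excess A B \<le> ereal r"
  shows "excess (closure A) (closure B) \<le> ereal r"
proof -
  have "excess (closure A) A \<le> ereal 0"
    unfolding excess_le_iff by (auto simp: closure_approachable dist_norm norm_minus_commute)
  moreover have "excess B (closure B) \<le> ereal 0"
    unfolding excess_le_iff using closure_subset by force
  ultimately show ?thesis
    using assms excess_triangle_le[of "closure A" A 0 B r]
      excess_triangle_le[of "closure A" B r "closure B" 0] by simp
qed

section \<open>Dropping summands from a sum of sets\<close>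

text \<open>A point of one sum is matched with a point of the other that uses the same summands on
  \<open>K\<close>. The two differ by a sum of elements of \<open>W i\<close> with \<open>i\<close>
  in \<open>L - K\<close>, whose norm is at most the sum of the \<open>c i\<close>.\<close>

lemma hausd_closed_sum_subset_le:
  assumes "finite L" "K \<subseteq> L"
    and W: "\<And>i. i \<in> L - K \<Longrightarrow> W i \<noteq> {} \<and> (\<forall>x\<in>W i. norm x \<le> c i)"
  shows "hausd (closed_sum W L) (closed_sum W K) \<le> ereal (\<Sum>i\<in>L-K. c i)"
proof -
  have fin: "finite K" "finite (L - K)"
    using assms finite_subset by auto
  have split: "sum s L - sum s K = sum s (L - K)" for s :: "'a \<Rightarrow> 'b"
    using assms(1,2) by (simp add: sum_diff)
  have small: "norm (sum s (L - K)) \<le> (\<Sum>i\<in>L-K. c i)" if "\<forall>i\<in>L-K. s i \<in> W i" for s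
    using that W by (intro sum_norm_le) auto
  have "excess (sum W L) (sum W K) \<le> ereal (\<Sum>i\<in>L-K. c i)"
    unfolding excess_le_iff
  proof (intro ballI allI impI)
    fix x e assume "x \<in> sum W L" and "(0::real) < e"
    then obtain s where s: "x = sum s L" "\<forall>i\<in>L. s i \<in> W i"
      using assms(1) by (auto simp: set_sum_alt)
    then have "sum s K \<in> sum W K" using assms(2) fin by (auto simp: set_sum_alt)
    moreover have "norm (x - sum s K) < (\<Sum>i\<in>L-K. c i) + e"
      using small[of s] s \<open>0 < e\<close> by (simp add: split)
    ultimately show "\<exists>y\<in>sum W K. norm (x - y) < (\<Sum>i\<in>L-K. c i) + e" by blast
  qed
  moreover have "excess (sum W K) (sum W L) \<le> ereal (\<Sum>i\<in>L-K. c i)"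
    unfolding excess_le_iff
  proof (intro ballI allI impI)
    fix y e assume "y \<in> sum W K" and "(0::real) < e"
    then obtain s where s: "y = sum s K" "\<forall>i\<in>K. s i \<in> W i"
      using fin by (auto simp: set_sum_alt)
    \<comment> \<open>The choice on \<open>K\<close> is extended to \<open>L\<close> by arbitrary
      points; they exist because \<open>W i\<close> is nonempty outside \<open>K\<close>.\<close>
    define u where "u i = (if i \<in> K then s i else SOME x. x \<in> W i)" for i
    have u: "\<forall>i\<in>L. u i \<in> W i" using s W by (auto simp: u_def some_in_eq)
    have y: "y = sum u K" using s by (simp add: u_def)
    have "sum u L \<in> sum W L" using u assms(1) by (auto simp: set_sum_alt)
    moreover have "norm (y - sum u L) < (\<Sum>i\<in>L-K. c i) + e"
      using small[of u] u y \<open>0 < e\<close> by (simp add: split norm_minus_commute[of "sum u K"])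
    ultimately show "\<exists>x\<in>sum W L. norm (y - x) < (\<Sum>i\<in>L-K. c i) + e" by blast
  qed
  ultimately show ?thesis
    by (simp add: hausd_le_iff closed_sum_def excess_closure_le)
qed

lemma bounded_multifunctionE:
  assumes "bounded_multifunction T F"
  obtains C where "C \<ge> 0" "\<And>t x. t \<in> T \<Longrightarrow> x \<in> F t \<Longrightarrow> norm x \<le> C"
proof -
  obtain C where C: "C \<ge> 0" "\<forall>t\<in>T. hausd (F t) {0} \<le> ereal C"
    using assms by (auto simp: bounded_multifunction_def)
  have "norm x \<le> C" if "t \<in> T" "x \<in> F t" for t x
  proof (rule field_le_epsilon)
    fix e :: real assume "0 < e"
    then show "norm x \<le> C + e"
      using C(2) that by (auto simp: hausd_le_iff excess_le_iff intro: less_imp_le)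
  qed
  with C(1) show ?thesis by (rule that)
qed

text \<open>Each dropped member \<open>A\<close> costs at most \<open>C * measure M A\<close>. By
  disjointness these costs add up to \<open>C\<close> times the measure of a set that misses
  \<open>\<Union>K\<close>. The resulting bound depends on \<open>K\<close> alone, so any family
  \<open>L\<close> of this kind containing \<open>K\<close> can be compared with it.\<close>

lemma hausd_weighted_subset_le:
  assumes "finite_measure M" "C \<ge> 0"
    and F: "\<forall>t\<in>space M. F t \<noteq> {} \<and> (\<forall>x\<in>F t. norm x \<le> C)"
    and L: "finite L" "L \<subseteq> sets M" "disjoint L" "K \<subseteq> L" "\<forall>A\<in>L. t A \<in> A"
  shows "hausd (closed_sum (\<lambda>A. weighted M F (t A) A) L) (closed_sum (\<lambda>A. weighted M F (t A) A) K)
    \<le> ereal (C * measure M (space M - \<Union>K))"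
proof -
  interpret finite_measure M by fact
  have fin: "finite (L - K)" "finite K" using L by (auto intro: finite_subset)
  have sp: "t A \<in> space M" if "A \<in> L" for A
    using that L sets.sets_into_space by blast
  have "hausd (closed_sum (\<lambda>A. weighted M F (t A) A) L) (closed_sum (\<lambda>A. weighted M F (t A) A) K)
      \<le> ereal (\<Sum>A\<in>L-K. measure M A * C)"
  proof (rule hausd_closed_sum_subset_le[OF L(1,4)])
    fix A assume "A \<in> L - K"
    then have "t A \<in> space M" using sp by blast
    then show "weighted M F (t A) A \<noteq> {} \<and> (\<forall>x\<in>weighted M F (t A) A. norm x \<le> measure M A * C)"
      using F by (simp add: weighted_def mult_left_mono)
  qed
  also have "(\<Sum>A\<in>L-K. measure M A * C) = C * measure M (\<Union>(L - K))"
  proof -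
    have "measure M (\<Union>A\<in>L-K. A) = (\<Sum>A\<in>L-K. measure M A)"
      using fin L by (intro finite_measure_finite_Union)
        (auto simp: disjoint_family_on_def disjoint_def)
    then show ?thesis by (simp add: sum_distrib_left mult.commute)
  qed
  also have "\<dots> \<le> C * measure M (space M - \<Union>K)"
  proof (intro mult_left_mono finite_measure_mono)
    show "\<Union>(L - K) \<subseteq> space M - \<Union>K"
    proof
      fix x assume "x \<in> \<Union>(L - K)"
      then obtain A where A: "A \<in> L" "A \<notin> K" "x \<in> A" by blast
      then have "x \<notin> B" if "B \<in> K" for B
        using that L(3,4) disjointD[of L A B] by blast
      moreover have "x \<in> space M" using A L(2) sets.sets_into_space by blast
      ultimately show "x \<in> space M - \<Union>K" by blast
    qed
    show "space M - \<Union>K \<in> sets M"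
      using L fin by (intro sets.compl_sets sets.finite_Union) auto
  qed (use assms in auto)
  finally show ?thesis by simp
qed

lemma closed_sum_cong: "(\<And>i. i \<in> K \<Longrightarrow> W i = V i) \<Longrightarrow> closed_sum W K = closed_sum V K"
  by (simp add: closed_sum_def cong: sum.cong)

lemma closed_sum_reindex: "inj_on A J \<Longrightarrow> closed_sum W (A ` J) = closed_sum (\<lambda>i. W (A i)) J"
  by (simp add: closed_sum_def sum.reindex)

section \<open>Tails and completions of countable partitions\<close>

lemma enumeration_exists:
  assumes "countable P"
  obtains A where "enumeration A P"
proof (cases "finite P")
  case True
  then show ?thesis
    using ex_bij_betw_nat_finite[of P] that
    by (auto simp: index_set_def enumeration_def atLeast0LessThan)
next
  case False
  then show ?thesis
    using bij_betw_from_nat_into[OF assms] that by (auto simp: index_set_def enumeration_def)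
qed

text \<open>The tails decrease, and their intersection is empty since \<open>P\<close> covers the
  space, so continuity from above of a finite measure applies.\<close>

lemma enumeration_tail_measure:
  assumes "finite_measure M" "countable_partition M P" "enumeration A P"
  shows "(\<lambda>n. measure M (space M - \<Union>(A ` ({..<n} \<inter> index_set P)))) \<longlonglongrightarrow> 0"
proof -
  interpret finite_measure M by fact
  let ?V = "\<lambda>n. space M - \<Union>(A ` ({..<n} \<inter> index_set P))"
  have im: "A ` index_set P = P"
    using assms(3) by (simp add: enumeration_def bij_betw_def)
  have "range ?V \<subseteq> sets M"
    using assms(2) im by (fastforce simp: countable_partition_def)
  moreover have "decseq ?V"
    unfolding decseq_def by (intro allI impI Diff_mono Union_mono image_mono) auto
  moreover have "(\<Inter>n. ?V n) = {}"
  proof -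
    have "\<Union>P = space M"
      using assms(2) by (auto simp: countable_partition_def partition_on_def)
    then have "\<exists>i\<in>index_set P. x \<in> A i" if "x \<in> space M" for x
      using that im by (metis UnionE imageE)
    \<comment> \<open>Stage \<open>n\<close> removes the indices strictly below \<open>n\<close>, so
      \<open>A i\<close> is gone only from stage \<open>Suc i\<close> on.\<close>
    moreover have "x \<notin> ?V (Suc i)" if "i \<in> index_set P" "x \<in> A i" for x i
      using that by auto
    ultimately have "x \<notin> (\<Inter>n. ?V n)" if "x \<in> space M" for x
      using that by (meson INT_D UNIV_I)
    then show ?thesis by auto
  qed
  ultimately show ?thesis
    using finite_Lim_measure_decseq[of ?V] by (metis measure_empty)
qed

text \<open>The tail of a partition that starts with the members of \<open>K\<close>, cut along \<open>Q\<close>.\<close>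

definition complete_along :: "'a set set \<Rightarrow> 'a set set \<Rightarrow> 'a set set" where
  "complete_along Q K = K \<union> ((\<lambda>B. B - \<Union>K) ` Q - {{}})"

text \<open>Each added piece lies in one member of \<open>Q\<close> and avoids
  \<open>\<Union>K\<close>, while the members of \<open>K\<close> lie in members of \<open>Q\<close>
  by assumption; this gives both disjointness and refinement.\<close>

lemma complete_along_partition:
  assumes Q: "countable_partition M Q" and K: "finite K" "K \<subseteq> sets M" "disjoint K" "{} \<notin> K"
    "\<And>A. A \<in> K \<Longrightarrow> \<exists>B\<in>Q. A \<subseteq> B"
  shows "countable_partition M (complete_along Q K)"
    and "refines (space M) (complete_along Q K) Q"
proof -
  have Q': "partition_on (space M) Q" "Q \<subseteq> sets M" "countable Q"
    using Q by (auto simp: countable_partition_def)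
  have part: "partition_on (space M) (complete_along Q K)"
  proof (rule partition_onI)
    show "\<Union>(complete_along Q K) = space M"
    proof
      show "\<Union>(complete_along Q K) \<subseteq> space M"
        using K(2) Q'(2) sets.sets_into_space unfolding complete_along_def by blast
      show "space M \<subseteq> \<Union>(complete_along Q K)"
      proof
        fix x assume "x \<in> space M"
        then obtain B where "B \<in> Q" "x \<in> B" using partition_onD1[OF Q'(1)] by blast
        then show "x \<in> \<Union>(complete_along Q K)"
        proof (cases "x \<in> \<Union>K")
          case True
          then show ?thesis by (simp add: complete_along_def)
        next
          case False
          with \<open>B \<in> Q\<close> \<open>x \<in> B\<close> have "B - \<Union>K \<in> complete_along Q K" "x \<in> B - \<Union>K"
            unfolding complete_along_def by blast+
          then show ?thesis by (rule UnionI)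
        qed
      qed
    qed
    fix C D assume CD: "C \<in> complete_along Q K" "D \<in> complete_along Q K" "C \<noteq> D"
    have *: "E \<in> K \<or> (\<exists>B\<in>Q. E = B - \<Union>K)" if "E \<in> complete_along Q K" for E
      using that by (auto simp: complete_along_def)
    have "disjnt A B" if "A \<in> Q" "B \<in> Q" "A \<noteq> B" for A B
      using that partition_onD2[OF Q'(1)] by (auto simp: disjoint_def disjnt_def)
    moreover have "disjnt A B" if "A \<in> K" "B \<in> K" "A \<noteq> B" for A B
      using that K(3) by (auto simp: disjoint_def disjnt_def)
    \<comment> \<open>Two members of \<open>K\<close> are disjoint by assumption, two added pieces
      because they come from different members of \<open>Q\<close>, and a mixed pair because the
      added piece avoids \<open>\<Union>K\<close>.\<close>
    ultimately show "disjnt C D"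
      using *[OF CD(1)] *[OF CD(2)] CD(3) unfolding disjnt_iff by (metis DiffE UnionI)
  qed (use K in \<open>auto simp: complete_along_def\<close>)
  have "\<Union>K \<in> sets M" using K by (intro sets.finite_Union) auto
  then show "countable_partition M (complete_along Q K)"
    using part Q' K by (auto simp: countable_partition_def complete_along_def countable_finite)
  show "refines (space M) (complete_along Q K) Q"
    using part Q' K by (auto simp: refines_def complete_along_def)
qed

section \<open>The two implications between the integrals\<close>

text \<open>The finite partition \<open>Q\<close> that the Gould condition gives for
  \<open>\<epsilon>\<close> also serves as the countable one. The first \<open>n\<close> members of
  a finer countable partition, completed along \<open>Q\<close>, form a finite partition finer than
  \<open>Q\<close>; its sum is within \<open>\<epsilon>\<close> of \<open>I\<close> and differs from
  the partial sum by at most the cost of the tail.\<close>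

lemma gould_imp_birkhoff_simple:
  assumes "finite_measure M" "C \<ge> 0"
    and F: "\<forall>t\<in>space M. F t \<noteq> {} \<and> (\<forall>x\<in>F t. norm x \<le> C)"
    and G: "has_gould_integral M F I"
  shows "has_birkhoff_simple_integral M F I"
  unfolding has_birkhoff_simple_integral_def
proof (intro conjI allI impI)
  show "I \<noteq> {}" "closed I" "bounded I" using G by (auto simp: has_gould_integral_def)
  fix \<epsilon> :: real assume "0 < \<epsilon>"
  then obtain Q where Q: "finite_partition M Q"
    and QI: "\<And>P t. finite_partition M P \<Longrightarrow> refines (space M) P Q \<Longrightarrow> (\<And>A. A \<in> P \<Longrightarrow> t A \<in> A) \<Longrightarrow>
           hausd (closed_sum (\<lambda>A. weighted M F (t A) A) P) I < ereal \<epsilon>"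
    using G unfolding has_gould_integral_def by blast
  have Qc: "countable_partition M Q" "finite Q" using Q by (auto simp: finite_partition_iff)
  have "limsup (\<lambda>n. hausd (closed_sum (\<lambda>i. weighted M F (t i) (A i)) ({..<n} \<inter> index_set P)) I)
      \<le> ereal \<epsilon>"
    if P: "countable_partition M P" "refines (space M) P Q" and A: "enumeration A P"
      and t: "\<And>i. i \<in> index_set P \<Longrightarrow> t i \<in> A i" for P A t
  proof -
    let ?J = "\<lambda>n. {..<n} \<inter> index_set P"
    let ?s = "\<lambda>n. closed_sum (\<lambda>i. weighted M F (t i) (A i)) (?J n)"
    let ?V = "\<lambda>n. space M - \<Union>(A ` ?J n)"
    have bij: "inj_on A (index_set P)" "A ` index_set P = P"
      using A by (auto simp: enumeration_def bij_betw_def)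
    have bound: "hausd (?s n) I \<le> ereal (C * measure M (?V n) + \<epsilon>)" for n
    proof -
      let ?K = "A ` ?J n" and ?L = "complete_along Q (A ` ?J n)"
      \<comment> \<open>Birkhoff tags belong to indices, Gould tags to sets: on the first members
        \<open>u\<close> recovers \<open>t\<close> through the inverse of the enumeration. On the
        added pieces any point will do, since the Gould condition holds for all tags.\<close>
      define u where "u S = (if S \<in> ?K then t (inv_into (index_set P) A S) else SOME x. x \<in> S)" for S
      have KP: "?K \<subseteq> P" using bij by auto
      have KL: "?K \<subseteq> ?L" by (simp add: complete_along_def)
      have L: "countable_partition M ?L" "refines (space M) ?L Q"
      proof -
        have "finite ?K" by simp
        moreover have "?K \<subseteq> sets M" "{} \<notin> ?K"
          using KP P(1) unfolding countable_partition_def partition_on_def by blast+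
        moreover have "disjoint ?K"
          using KP P(1) unfolding countable_partition_def partition_on_def
          by (metis pairwise_subset)
        moreover have "\<exists>B\<in>Q. S \<subseteq> B" if "S \<in> ?K" for S
          using that KP P(2) unfolding refines_def by blast
        ultimately show "countable_partition M ?L" "refines (space M) ?L Q"
          using complete_along_partition[OF Qc(1)] by blast+
      qed
      have finL: "finite ?L" using Qc by (simp add: complete_along_def)
      have Lp: "?L \<subseteq> sets M" "disjoint ?L" "{} \<notin> ?L"
        using L(1) by (auto simp: countable_partition_def partition_on_def)
      have u: "u S \<in> S" if "S \<in> ?L" for S
      proof (cases "S \<in> ?K")
        case True
        then show ?thesis using t bij by (auto simp: u_def)
      next
        case False
        then show ?thesis using that Lp by (auto simp: u_def some_in_eq)
      qed
      have "?s n = closed_sum (\<lambda>i. weighted M F (u (A i)) (A i)) (?J n)"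
        using bij by (intro closed_sum_cong) (auto simp: u_def)
      also have "\<dots> = closed_sum (\<lambda>S. weighted M F (u S) S) ?K"
        using bij by (subst closed_sum_reindex) (auto intro: inj_on_subset)
      finally have s: "?s n = closed_sum (\<lambda>S. weighted M F (u S) S) ?K" .
      have "hausd (closed_sum (\<lambda>S. weighted M F (u S) S) ?L) I \<le> ereal \<epsilon>"
        using L finL u by (intro less_imp_le QI) (auto simp: finite_partition_iff)
      moreover have "hausd (?s n) (closed_sum (\<lambda>S. weighted M F (u S) S) ?L)
          \<le> ereal (C * measure M (?V n))"
        unfolding s using hausd_weighted_subset_le[OF assms(1,2) F finL Lp(1,2) KL, of u] u
        by (simp add: hausd_commute)
      ultimately show ?thesis using hausd_triangle_le by blast
    qed
    show ?thesis
    proof (rule ereal_le_epsilon2)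
      fix \<delta> :: real assume "0 < \<delta>"
      \<comment> \<open>The cost of the tail is eventually below any given \<open>\<delta>\<close>,
        so it does not enlarge the upper limit.\<close>
      have "(\<lambda>n. C * measure M (?V n)) \<longlonglongrightarrow> C * 0"
        by (intro tendsto_mult_left enumeration_tail_measure[OF assms(1) P(1) A])
      then have "\<forall>\<^sub>F n in sequentially. C * measure M (?V n) < \<delta>"
        using \<open>0 < \<delta>\<close> by (intro order_tendstoD) auto
      then have "\<forall>\<^sub>F n in sequentially. hausd (?s n) I \<le> ereal \<epsilon> + ereal \<delta>"
      proof (rule eventually_mono)
        fix n assume "C * measure M (?V n) < \<delta>"
        then show "hausd (?s n) I \<le> ereal \<epsilon> + ereal \<delta>"
          by (intro order_trans[OF bound[of n]]) simp
      qed
      then show "limsup (\<lambda>n. hausd (?s n) I) \<le> ereal \<epsilon> + ereal \<delta>"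
        by (rule Limsup_bounded)
    qed
  qed
  then show "\<exists>Q. countable_partition M Q \<and>
      (\<forall>P A t. countable_partition M P \<and> refines (space M) P Q \<and> enumeration A P \<and>
        (\<forall>i\<in>index_set P. t i \<in> A i) \<longrightarrow>
        limsup (\<lambda>n. hausd (closed_sum (\<lambda>i. weighted M F (t i) (A i)) ({..<n} \<inter> index_set P)) I)
          \<le> ereal \<epsilon>)"
    using Qc(1) by blast
qed

text \<open>A finite part \<open>H\<close> of the Birkhoff partition \<open>Q\<close> carries almost
  all of the measure; \<open>Q'\<close> consists of \<open>H\<close> and the remainder. A finite
  partition \<open>P\<close> finer than \<open>Q'\<close> may fail to refine \<open>Q\<close> on the
  remainder. So only its members inside \<open>H\<close> are kept, and they are completed along
  \<open>Q\<close> to a partition \<open>R\<close> to which the Birkhoff condition applies.\<close>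

lemma birkhoff_simple_imp_gould:
  assumes "finite_measure M" "space M \<noteq> {}" "C \<ge> 0"
    and F: "\<forall>t\<in>space M. F t \<noteq> {} \<and> (\<forall>x\<in>F t. norm x \<le> C)"
    and B: "has_birkhoff_simple_integral M F I"
  shows "has_gould_integral M F I"
  unfolding has_gould_integral_def
proof (intro conjI allI impI)
  interpret finite_measure M by fact
  show "I \<noteq> {}" "closed I" "bounded I" using B by (auto simp: has_birkhoff_simple_integral_def)
  fix \<epsilon> :: real assume "0 < \<epsilon>"
  \<comment> \<open>The error is \<open>e\<close> for passing from \<open>P\<close> to
    \<open>K\<close>, \<open>e\<close> for passing from \<open>K\<close> to a long partial sum over
    \<open>R\<close>, and \<open>2 * e\<close> for the distance of that sum from \<open>I\<close>.
    The total \<open>4 * e\<close> leaves room for a strict inequality.\<close>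
  define e where "e = \<epsilon> / 5"
  have e: "e > 0" using \<open>0 < \<epsilon>\<close> by (simp add: e_def)
  let ?ok = "\<lambda>Q. countable_partition M Q \<and>
      (\<forall>P A t. countable_partition M P \<and> refines (space M) P Q \<and> enumeration A P \<and>
        (\<forall>i\<in>index_set P. t i \<in> A i) \<longrightarrow>
        limsup (\<lambda>n. hausd (closed_sum (\<lambda>i. weighted M F (t i) (A i)) ({..<n} \<inter> index_set P)) I)
          \<le> ereal e)"
  have "\<exists>Q. ?ok Q"
    using B e unfolding has_birkhoff_simple_integral_def by (elim conjE allE[of _ e]) simp
  then obtain Q where ok: "?ok Q" by (rule exE)
  then have Q: "countable_partition M Q" by (rule conjunct1)
  have QI: "limsup (\<lambda>n. hausd (closed_sum (\<lambda>i. weighted M F (t i) (A i)) ({..<n} \<inter> index_set P)) I)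
      \<le> ereal e"
    if "countable_partition M P" "refines (space M) P Q" "enumeration A P"
      "\<And>i. i \<in> index_set P \<Longrightarrow> t i \<in> A i" for P A t
    using ok that by (elim conjE allE[of _ P] allE[of _ A] allE[of _ t]) simp
  have Qp: "\<Union>Q = space M" "disjoint Q" "{} \<notin> Q" "Q \<subseteq> sets M" "countable Q"
    using Q by (auto simp: countable_partition_def partition_on_def)
  obtain D where D: "enumeration D Q" using enumeration_exists[OF Qp(5)] .
  have DQ: "D ` index_set Q = Q" using D by (auto simp: enumeration_def bij_betw_def)
  have "(\<lambda>n. C * measure M (space M - \<Union>(D ` ({..<n} \<inter> index_set Q)))) \<longlonglongrightarrow> C * 0"
    by (intro tendsto_mult_left enumeration_tail_measure[OF assms(1) Q D])
  then have "\<forall>\<^sub>F n in sequentially. C * measure M (space M - \<Union>(D ` ({..<n} \<inter> index_set Q))) < e"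
    using e by (intro order_tendstoD) auto
  then obtain N where N: "C * measure M (space M - \<Union>(D ` ({..<N} \<inter> index_set Q))) < e"
    by (auto dest: eventually_happens)
  define H where "H = D ` ({..<N} \<inter> index_set Q)"
  have H: "finite H" "H \<subseteq> Q" "C * measure M (space M - \<Union>H) < e"
    using N DQ by (auto simp: H_def)
  \<comment> \<open>Completing along the one-member partition \<open>{space M}\<close> merges the
    whole tail into the set \<open>space M - \<Union>H\<close>, which is left out if empty.\<close>
  define Q' where "Q' = complete_along {space M} H"
  have "finite_partition M Q'"
  proof -
    have "countable_partition M {space M}"
      using assms(2) by (auto simp: countable_partition_def partition_on_def)
    moreover have "disjoint H" using Qp H by (blast intro: pairwise_subset)
    moreover have "H \<subseteq> sets M" "{} \<notin> H" "\<And>A. A \<in> H \<Longrightarrow> A \<subseteq> space M" using Qp H by auto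
    ultimately have "countable_partition M Q'"
      unfolding Q'_def using H by (intro complete_along_partition) auto
    then show ?thesis using H by (simp add: finite_partition_iff Q'_def complete_along_def)
  qed
  moreover have "hausd (closed_sum (\<lambda>A. weighted M F (t A) A) P) I < ereal \<epsilon>"
    if P: "finite_partition M P" "refines (space M) P Q'" and t: "\<And>A. A \<in> P \<Longrightarrow> t A \<in> A" for P t
  proof -
    let ?S = "\<lambda>t P. closed_sum (\<lambda>A. weighted M F (t A) A) P"
    have Pp: "\<Union>P = space M" "disjoint P" "{} \<notin> P" "P \<subseteq> sets M" "finite P"
      using P by (auto simp: finite_partition_def partition_on_def)
    \<comment> \<open>Since \<open>P\<close> refines \<open>Q'\<close>, the members of
      \<open>P\<close> outside \<open>K\<close> lie in \<open>space M - \<Union>H\<close>. Hence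
      what \<open>K\<close> leaves uncovered is no larger than that small remainder.\<close>
    define K where "K = {A \<in> P. \<exists>B\<in>H. A \<subseteq> B}"
    have KP: "K \<subseteq> P" and KQ: "\<And>A. A \<in> K \<Longrightarrow> \<exists>B\<in>Q. A \<subseteq> B"
      using H by (auto simp: K_def)
    have K: "finite K" "K \<subseteq> sets M" "disjoint K" "{} \<notin> K"
      using Pp KP by (auto intro: finite_subset pairwise_subset)
    have "space M - \<Union>K \<subseteq> space M - \<Union>H"
    proof
      fix x assume x: "x \<in> space M - \<Union>K"
      then obtain A where A: "A \<in> P" "x \<in> A" using Pp by blast
      then have "A \<notin> K" using x by blast
      obtain E where E: "E \<in> Q'" "A \<subseteq> E" using P A unfolding refines_def by blast
      then have "E = space M - \<Union>H"
        using A \<open>A \<notin> K\<close> by (auto simp: Q'_def complete_along_def K_def)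
      then show "x \<in> space M - \<Union>H" using A E by blast
    qed
    then have "measure M (space M - \<Union>K) \<le> measure M (space M - \<Union>H)"
      using H Qp by (intro finite_measure_mono) (auto intro!: sets.compl_sets sets.finite_Union)
    then have small: "C * measure M (space M - \<Union>K) \<le> e"
      using H(3) mult_left_mono[OF _ assms(3)] by (meson less_imp_le order_trans)
    define R where "R = complete_along Q K"
    have R: "countable_partition M R" "refines (space M) R Q"
      unfolding R_def using complete_along_partition[OF Q K KQ] by auto
    have Rp: "disjoint R" "{} \<notin> R" "R \<subseteq> sets M" "countable R"
      using R by (auto simp: countable_partition_def partition_on_def)
    have KR: "K \<subseteq> R" by (simp add: R_def complete_along_def)
    obtain A where A: "enumeration A R" using enumeration_exists[OF Rp(4)] .
    have bij: "inj_on A (index_set R)" "A ` index_set R = R"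
      using A by (auto simp: enumeration_def bij_betw_def)
    \<comment> \<open>The tags agree with \<open>t\<close> on \<open>K\<close>, so the sums over
      \<open>K\<close> for \<open>P\<close> and for \<open>R\<close> are the same set.\<close>
    define u where "u S = (if S \<in> K then t S else SOME x. x \<in> S)" for S
    have u: "u S \<in> S" if "S \<in> R" for S
      using that t KP Rp by (auto simp: u_def some_in_eq)
    let ?J = "\<lambda>n. {..<n} \<inter> index_set R"
    let ?s = "\<lambda>n. closed_sum (\<lambda>i. weighted M F (u (A i)) (A i)) (?J n)"
    have "limsup (\<lambda>n. hausd (?s n) I) \<le> ereal e"
      using R A u bij by (intro QI) auto
    \<comment> \<open>An upper limit of at most \<open>e\<close> bounds the late terms only by
      numbers above \<open>e\<close>; \<open>2 * e\<close> is one such number.\<close>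
    also have "ereal e < ereal (2 * e)" using e by simp
    finally have ev1: "\<forall>\<^sub>F n in sequentially. hausd (?s n) I < ereal (2 * e)"
      by (rule Limsup_lessD)
    \<comment> \<open>The enumeration of \<open>R\<close> need not start with \<open>K\<close>, but
      it has listed the finitely many members of \<open>K\<close> after some stage. From then on the
      partial sum extends the sum over \<open>K\<close>.\<close>
    have ev2: "\<forall>\<^sub>F n in sequentially. K \<subseteq> A ` ?J n"
    proof -
      obtain G where G: "finite G" "G \<subseteq> index_set R" "K = A ` G"
        using finite_subset_image[OF K(1), of A "index_set R"] KR bij by auto
      then obtain m where "G \<subseteq> {..<m}" using finite_nat_iff_bounded by blast
      then have "K \<subseteq> A ` ?J n" if "n \<ge> m" for n using G that by fastforce
      then show ?thesis by (auto simp: eventually_sequentially)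
    qed
    obtain n where n: "hausd (?s n) I < ereal (2 * e)" "K \<subseteq> A ` ?J n"
      using eventually_happens[OF eventually_conj[OF ev1 ev2]] by auto
    let ?L = "A ` ?J n"
    have L: "finite ?L" "?L \<subseteq> R" using bij by auto
    then have Lp: "?L \<subseteq> sets M" "disjoint ?L" using Rp by (auto intro: pairwise_subset)
    have "?s n = ?S u ?L"
      using bij by (subst closed_sum_reindex) (auto intro: inj_on_subset)
    then have "hausd (?S u ?L) I \<le> ereal (2 * e)" using n(1) by (simp add: less_imp_le)
    moreover have "hausd (?S u K) (?S u ?L) \<le> ereal e"
    proof -
      have "hausd (?S u ?L) (?S u K) \<le> ereal (C * measure M (space M - \<Union>K))"
        using u L by (intro hausd_weighted_subset_le[OF assms(1,3) F L(1) Lp n(2)]) blast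
      then show ?thesis unfolding hausd_commute[of "?S u K"]
        using small by (meson ereal_less_eq(3) order_trans)
    qed
    moreover have "?S u K = ?S t K" by (intro closed_sum_cong) (simp add: u_def)
    moreover have "hausd (?S t P) (?S t K) \<le> ereal e"
    proof -
      have "hausd (?S t P) (?S t K) \<le> ereal (C * measure M (space M - \<Union>K))"
        using t by (intro hausd_weighted_subset_le[OF assms(1,3) F Pp(5,4,2) KP]) blast
      then show ?thesis using small by (meson ereal_less_eq(3) order_trans)
    qed
    ultimately have "hausd (?S t P) I \<le> ereal (e + (e + 2 * e))"
      by (intro hausd_triangle_le[of _ "?S t K"] hausd_triangle_le[of _ "?S u ?L"]) simp_all
    also have "\<dots> < ereal \<epsilon>" using \<open>0 < \<epsilon>\<close> by (simp add: e_def)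
    finally show ?thesis .
  qed
  ultimately show "\<exists>Q. finite_partition M Q \<and> (\<forall>B\<in>Q. emeasure M B < \<infinity>) \<and>
      (\<forall>P t. finite_partition M P \<and> refines (space M) P Q \<and> (\<forall>A\<in>P. t A \<in> A) \<longrightarrow>
        hausd (closed_sum (\<lambda>A. weighted M F (t A) A) P) I < ereal \<epsilon>)"
    by (intro exI[of _ Q']) (auto simp: less_top[symmetric])
qed

theorem theorem3p8:
  fixes M :: "'a measure" and F :: "'a \<Rightarrow> 'x::banach set"
  assumes "uncountable (space M)"
    and "finite_measure M"
    and "measure M (space M) > 0"
    and "\<And>t. t \<in> space M \<Longrightarrow> F t \<noteq> {} \<and> bounded (F t)"
    and "bounded_multifunction (space M) F"
  shows "(birkhoff_simple_integrable M F \<longleftrightarrow> gould_integrable M F) \<and>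
    (gould_integrable M F \<longrightarrow> birkhoff_simple_integral M F = gould_integral M F)"
proof -
  obtain C where "C \<ge> 0" and F: "\<forall>t\<in>space M. F t \<noteq> {} \<and> (\<forall>x\<in>F t. norm x \<le> C)"
    using bounded_multifunctionE[OF assms(5)] assms(4) by metis
  moreover have "space M \<noteq> {}" using assms(1) by auto
  \<comment> \<open>The two predicates agree for every candidate set, so the existence statements
    and the \<open>THE\<close> terms built from them coincide as well.\<close>
  ultimately have "has_birkhoff_simple_integral M F = has_gould_integral M F"
    using gould_imp_birkhoff_simple[OF assms(2)] birkhoff_simple_imp_gould[OF assms(2)]
    by (intro ext iffI) simp_all
  then show ?thesis
    by (simp add: birkhoff_simple_integrable_def gould_integrable_def
        birkhoff_simple_integral_def gould_integral_def)
qed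

end
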